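(* Let $L>0$, let $f\colon\mathbb{R}^n\to\mathbb{R}$ be convex and $L$-smooth, and assume $f$ has a minimizer $X_\star$; write $f_\star=f(X_\star)$. Let $s\in\left(0,\frac{2}{L}\right]$ and $X_0\in\mathbb{R}^n$. Set $\theta_k=\frac{k}{2}$ and define sequences by $x_0=z_0=X_0$ and, for $k=0,1,2,\dots$, $$x_k^+=x_k-\frac{s}{2}\nabla f(x_k),\qquad z_{k+1}=z_k-s\theta_k\nabla f(x_k),\qquad x_{k+1}=\frac{\theta_k^2}{\theta_{k+1}^2}x_k^+ +\left(1-\frac{\theta_k^2}{\theta_{k+1}^2}\right)z_{k+1}.$$ Then for all $k=1,2,\dots$, $$f(x_k^+)-f_\star\le\frac{2\|X_0-X_\star\|^2}{s k^2}.$$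
   Context: $\|\cdot\|$ is the Euclidean norm on $\mathbb{R}^n$. A function $f\colon\mathbb{R}^n\to\mathbb{R}$ is $L$-smooth if it is differentiable and $\|\nabla f(x)-\nabla f(y)\|\le L\|x-y\|$ for all $x,y\in\mathbb{R}^n$. *)

theory Defs
  imports "HOL-Analysis.Analysis"
begin

text \<open>The value is meaningful only at points of differentiability, where it is the unique
  vector representing the derivative; see \<open>GDERIV_gradient\<close> below.\<close>

definition gradient :: "('a::euclidean_space \<Rightarrow> real) \<Rightarrow> 'a \<Rightarrow> 'a" where
  "gradient f x = (THE D. GDERIV f x :> D)"

definition L_smooth :: "real \<Rightarrow> ('a::euclidean_space \<Rightarrow> real) \<Rightarrow> bool" where
  "L_smooth L f \<longleftrightarrow>
     (\<forall>x. f differentiable (at x)) \<and>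
     (\<forall>x y. norm (gradient f x - gradient f y) \<le> L * norm (x - y))"

lemma gradient_eqI:
  assumes "GDERIV f x :> D"
  shows "gradient f x = D"
  unfolding gradient_def
proof (rule the_equality[where P = "\<lambda>D. GDERIV f x :> D", OF assms])
  fix E assume "GDERIV f x :> E"
  with assms have "(\<lambda>h. inner h E) = (\<lambda>h. inner h D)"
    unfolding gderiv_def by (rule has_derivative_unique[rotated])
  then show "E = D"
    by (metis inner_commute vector_eq_rdot)
qed

lemma GDERIV_gradient:
  assumes "f differentiable (at x)"
  shows "GDERIV f x :> gradient f x"
proof -
  from assms obtain f' where f': "(f has_derivative f') (at x)"
    unfolding differentiable_def by blast
  then interpret bounded_linear f'
    by (rule has_derivative_bounded_linear)
  have "f' h = inner h (adjoint f' 1)" for h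
    using adjoint_works[OF linear_axioms, of h 1] by simp
  then have "f' = (\<lambda>h. inner h (adjoint f' 1))"
    by (rule ext)
  with f' have "GDERIV f x :> adjoint f' 1"
    unfolding gderiv_def by simp
  then show ?thesis
    using gradient_eqI by metis
qed

end

theory Submission
  imports Defs
begin

text \<open>
  Write \<open>h = s / 2\<close>, so that \<open>0 < h \<le> 1 / L\<close>, let \<open>g k\<close> be the gradient at \<open>x k\<close>, and let
  \<open>F k = f (x k) - f X_star - h / 2 * (norm (g k))\<^sup>2\<close>. By the descent lemma \<open>F k\<close> dominates
  \<open>f (xplus k) - f X_star\<close>, so it suffices to bound \<open>F k\<close>. This is done with the potential
  \<open>V k = q k * F k + (norm (z (k + 1) - X_star))\<^sup>2 / (2 * h)\<close>, where
  \<open>q k = k\<^sup>2 * (k + 1) / (2 * k + 1)\<close>. Since \<open>q 0 = 0\<close> and \<open>z 1 = X\<^sub>0\<close>, it starts at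
  \<open>(norm (X\<^sub>0 - X_star))\<^sup>2 / (2 * h)\<close>, and \<open>q k \<ge> k\<^sup>2 / 2\<close>; the rate follows once \<open>V\<close> is
  known to be nonincreasing.

  For the step from \<open>k\<close> to \<open>k + 1\<close>, the cocoercive form of convexity (lemma
  \<open>smooth_convex_lower_bound\<close>) is used from \<open>x (k + 1)\<close> to \<open>x k\<close> with weight \<open>q k\<close>, and from
  \<open>x (k + 1)\<close> to \<open>X_star\<close> with weight \<open>k + 1\<close>. With these weights the definition of
  \<open>x (k + 1)\<close> makes all points combine to \<open>(k + 1) * (X_star - z (k + 1))\<close>, which is exactly the
  cross term in the expansion of the distance of \<open>z (k + 2)\<close> to \<open>X_star\<close>.
  The usual accelerated argument would take the weights \<open>2 * (\<theta> k)\<^sup>2\<close> and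
  \<open>2 * ((\<theta> (k + 1))\<^sup>2 - (\<theta> k)\<^sup>2)\<close>; for \<open>\<theta> k = k / 2\<close> these leave a multiple of the inner
  product of \<open>g (k + 1)\<close> and \<open>z (k + 1) - X_star\<close>, whose sign is unknown. Rescaling them by
  \<open>(2 * k + 2) / (2 * k + 1)\<close> removes that term, at the price of a coefficient
  \<open>(k + 1) ^ 3 / (2 * k + 1)\<close> of \<open>F (k + 1)\<close> that is slightly larger than \<open>q (k + 1)\<close>; the
  surplus can be dropped because \<open>F\<close> is nonnegative.
\<close>

section \<open>Smooth convex functions\<close>

lemma has_real_derivative_along_line:
  fixes f :: "'a::euclidean_space \<Rightarrow> real"
  assumes "f differentiable (at (x + t *\<^sub>R v))"
  shows "((\<lambda>t. f (x + t *\<^sub>R v)) has_real_derivative gradient f (x + t *\<^sub>R v) \<bullet> v) (at t)"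
proof -
  have "(f has_derivative (\<lambda>h. h \<bullet> gradient f (x + t *\<^sub>R v))) (at (x + t *\<^sub>R v))"
    using GDERIV_gradient[OF assms] by (simp add: gderiv_def)
  moreover have "((\<lambda>t. x + t *\<^sub>R v) has_derivative (\<lambda>u. u *\<^sub>R v)) (at t)"
    by (auto intro!: derivative_eq_intros)
  ultimately have "((\<lambda>t. f (x + t *\<^sub>R v)) has_derivative
      (\<lambda>u. (u *\<^sub>R v) \<bullet> gradient f (x + t *\<^sub>R v))) (at t)"
    by (rule has_derivative_compose[rotated])
  then show ?thesis
    by (simp add: has_field_derivative_def inner_commute mult.commute[of _ "v \<bullet> _"])
qed

lemma convex_above_tangent:
  fixes f :: "'a::euclidean_space \<Rightarrow> real"
  assumes "convex_on UNIV f" and "f differentiable (at x)"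
  shows "f x + gradient f x \<bullet> (y - x) \<le> f y"
proof -
  let ?\<phi> = "\<lambda>t. f (x + t *\<^sub>R (y - x))"
  have "convex_on UNIV ?\<phi>"
  proof (rule convex_onI)
    fix t a b :: real
    assume "0 < t" "t < 1"
    moreover have "x + ((1 - t) *\<^sub>R a + t *\<^sub>R b) *\<^sub>R (y - x) =
        (1 - t) *\<^sub>R (x + a *\<^sub>R (y - x)) + t *\<^sub>R (x + b *\<^sub>R (y - x))"
      by (simp add: algebra_simps)
    ultimately show "?\<phi> ((1 - t) *\<^sub>R a + t *\<^sub>R b) \<le> (1 - t) * ?\<phi> a + t * ?\<phi> b"
      using convex_onD[OF assms(1), of t "x + a *\<^sub>R (y - x)" "x + b *\<^sub>R (y - x)"] by simp
  qed simp
  moreover have "(?\<phi> has_real_derivative gradient f x \<bullet> (y - x)) (at 0)"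
    using has_real_derivative_along_line[of f x 0 "y - x"] assms(2) by simp
  ultimately have "?\<phi> 1 - ?\<phi> 0 \<ge> (gradient f x \<bullet> (y - x)) * (1 - 0)"
    by (intro convex_on_imp_above_tangent[where A = UNIV]) auto
  then show ?thesis by simp
qed

text \<open>Along the ray from \<open>x\<close> in direction \<open>v\<close>, the difference between the function and its
  quadratic upper model has derivative
  \<open>(gradient f (x + t v) - gradient f x) \<bullet> v - L * t * (norm v)\<^sup>2\<close>, which is nonpositive
  for \<open>t \<ge> 0\<close> by Cauchy--Schwarz and the Lipschitz bound.\<close>

lemma descent_lemma:
  fixes f :: "'a::euclidean_space \<Rightarrow> real"
  assumes "L_smooth L f"
  shows "f (x + v) \<le> f x + gradient f x \<bullet> v + L / 2 * (norm v)\<^sup>2"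
proof -
  let ?\<phi> = "\<lambda>t. f (x + t *\<^sub>R v) - t * (gradient f x \<bullet> v) - L / 2 * t\<^sup>2 * (norm v)\<^sup>2"
  have "?\<phi> 1 \<le> ?\<phi> 0"
  proof (rule DERIV_nonpos_imp_nonincreasing[of 0 1 ?\<phi>])
    fix t :: real
    assume t: "0 \<le> t" "t \<le> 1"
    let ?D = "gradient f (x + t *\<^sub>R v) \<bullet> v - gradient f x \<bullet> v - L * t * (norm v)\<^sup>2"
    have "(?\<phi> has_real_derivative ?D) (at t)"
      using assms unfolding L_smooth_def
      by (auto intro!: derivative_eq_intros has_real_derivative_along_line)
    moreover have "?D \<le> 0"
    proof -
      have "(gradient f (x + t *\<^sub>R v) - gradient f x) \<bullet> v
          \<le> norm (gradient f (x + t *\<^sub>R v) - gradient f x) * norm v"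
        by (rule norm_cauchy_schwarz)
      also have "\<dots> \<le> (L * norm (x + t *\<^sub>R v - x)) * norm v"
        using assms unfolding L_smooth_def by (blast intro: mult_right_mono norm_ge_zero)
      also have "\<dots> = L * t * (norm v)\<^sup>2"
        using t by (simp add: power2_eq_square)
      finally show ?thesis by (simp add: inner_diff_left)
    qed
    ultimately show "\<exists>y. (?\<phi> has_real_derivative y) (at t) \<and> y \<le> 0" by blast
  qed simp
  then show ?thesis by simp
qed

lemma gradient_step_decrease:
  fixes f :: "'a::euclidean_space \<Rightarrow> real"
  assumes "L_smooth L f" and "0 < h" and "h * L \<le> 1"
  shows "f (x - h *\<^sub>R gradient f x) \<le> f x - h / 2 * (norm (gradient f x))\<^sup>2"
proof -
  let ?g = "gradient f x"
  have "f (x - h *\<^sub>R ?g) \<le> f x - h * (norm ?g)\<^sup>2 + (h * L) * (h / 2 * (norm ?g)\<^sup>2)"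
    using descent_lemma[OF assms(1), of x "- (h *\<^sub>R ?g)"]
    by (simp add: power_mult_distrib power2_eq_square[of h] dot_square_norm algebra_simps)
  also have "(h * L) * (h / 2 * (norm ?g)\<^sup>2) \<le> 1 * (h / 2 * (norm ?g)\<^sup>2)"
    using assms by (intro mult_right_mono) auto
  finally show ?thesis by simp
qed

lemma gradient_at_minimizer:
  fixes f :: "'a::euclidean_space \<Rightarrow> real"
  assumes "L_smooth L f" and "L > 0" and "\<forall>y. f m \<le> f y"
  shows "gradient f m = 0"
proof -
  have "f m \<le> f (m - (1 / L) *\<^sub>R gradient f m)"
    using assms(3) by blast
  also have "\<dots> \<le> f m - (1 / L) / 2 * (norm (gradient f m))\<^sup>2"
    using assms(2) by (intro gradient_step_decrease[OF assms(1)]) auto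
  finally have "(norm (gradient f m))\<^sup>2 \<le> 0"
    using assms(2) by (simp add: field_simps)
  then show ?thesis by simp
qed

text \<open>Subtracting from \<open>f\<close> its tangent at \<open>x\<close> gives a smooth convex function with minimizer
  \<open>x\<close>, and a gradient step for it starting at \<open>y\<close> decreases its value by at least
  \<open>h / 2 * (norm (gradient f x - gradient f y))\<^sup>2\<close> without going below the minimum.\<close>

lemma smooth_convex_lower_bound:
  fixes f :: "'a::euclidean_space \<Rightarrow> real"
  assumes "L_smooth L f" and "convex_on UNIV f" and "0 < h" and "h * L \<le> 1"
  shows "f x + gradient f x \<bullet> (y - x) + h / 2 * (norm (gradient f x - gradient f y))\<^sup>2 \<le> f y"
proof -
  define d where "d = gradient f y - gradient f x"
  have "f x + gradient f x \<bullet> ((y - h *\<^sub>R d) - x) \<le> f (y - h *\<^sub>R d)"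
    using assms(1,2) unfolding L_smooth_def by (intro convex_above_tangent) auto
  moreover have "f (y - h *\<^sub>R d) \<le> f y - h * (gradient f y \<bullet> d) + (h * L) * (h / 2 * (norm d)\<^sup>2)"
    using descent_lemma[OF assms(1), of y "- (h *\<^sub>R d)"]
    by (simp add: power_mult_distrib power2_eq_square[of h] algebra_simps)
  moreover have "(h * L) * (h / 2 * (norm d)\<^sup>2) \<le> 1 * (h / 2 * (norm d)\<^sup>2)"
    using assms(3,4) by (intro mult_right_mono) auto
  moreover have "h * (gradient f y \<bullet> d) - h * (gradient f x \<bullet> d) = h * (norm d)\<^sup>2"
    by (simp add: d_def power2_norm_eq_inner inner_diff_left right_diff_distrib)
  moreover have "gradient f x \<bullet> ((y - h *\<^sub>R d) - x)
      = gradient f x \<bullet> (y - x) - h * (gradient f x \<bullet> d)"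
    by (simp add: inner_diff_right)
  moreover have "norm (gradient f x - gradient f y) = norm d"
    by (simp add: d_def norm_minus_commute)
  ultimately show ?thesis by simp
qed

section \<open>The decrease of the potential\<close>

text \<open>The energy \<open>f x - f m - h / 2 * (norm (gradient f x))\<^sup>2\<close> absorbs the gradient terms of
  the cocoercive bound: the displacement is then measured from the point after the gradient step,
  which is the point that enters the averaging step of the algorithm.\<close>

definition energy :: "real \<Rightarrow> ('a::euclidean_space \<Rightarrow> real) \<Rightarrow> 'a \<Rightarrow> 'a \<Rightarrow> real" where
  "energy h f m x = f x - f m - h / 2 * (norm (gradient f x))\<^sup>2"

lemma energy_lower_bound:
  fixes f :: "'a::euclidean_space \<Rightarrow> real"
  assumes "L_smooth L f" and "convex_on UNIV f" and "0 < h" and "h * L \<le> 1"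
  shows "energy h f m x + gradient f x \<bullet> (y - h *\<^sub>R gradient f y - x) + h * (norm (gradient f x))\<^sup>2
    \<le> energy h f m y"
proof -
  have "h / 2 * (norm (gradient f x - gradient f y))\<^sup>2 = h / 2 * (norm (gradient f x))\<^sup>2
      - h * (gradient f x \<bullet> gradient f y) + h / 2 * (norm (gradient f y))\<^sup>2"
    by (simp add: power2_norm_eq_inner inner_diff_left inner_diff_right inner_commute
        algebra_simps)
  then show ?thesis
    using smooth_convex_lower_bound[OF assms, of x y]
    by (simp add: energy_def inner_diff_right inner_commute power2_norm_eq_inner algebra_simps
        add_divide_distrib diff_divide_distrib)
qed

lemma energy_nonneg:
  fixes f :: "'a::euclidean_space \<Rightarrow> real"
  assumes "L_smooth L f" and "0 < h" and "h * L \<le> 1" and "\<forall>y. f m \<le> f y"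
  shows "0 \<le> energy h f m x"
  using gradient_step_decrease[OF assms(1-3), of x] assms(4)
  unfolding energy_def by (smt (verit))

definition energy_weight :: "nat \<Rightarrow> real" where
  "energy_weight k = (real k)\<^sup>2 * (real k + 1) / (2 * real k + 1)"

lemma energy_weight_ge: "(real k)\<^sup>2 / 2 \<le> energy_weight k"
proof -
  have "(real k)\<^sup>2 * (2 * real k + 1) \<le> (real k)\<^sup>2 * (2 * (real k + 1))"
    by (intro mult_left_mono) auto
  then show ?thesis
    by (simp add: energy_weight_def field_simps)
qed

lemma energy_weight_add: "energy_weight k + (real k + 1) = (real k + 1) ^ 3 / (2 * real k + 1)"
proof -
  have "2 * real k + 1 \<noteq> 0"
    using of_nat_0_le_iff[of k, where 'a = real] by linarith
  then show ?thesis
    by (simp add: energy_weight_def divide_simps) algebra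
qed

text \<open>After the common factor \<open>(k + 1)\<^sup>2\<close> is removed, this says that \<open>m / (2 * m - 1)\<close>
  decreases from \<open>m = k + 1\<close> to \<open>m = k + 2\<close>. It is what allows each step to hand over less of
  the energy than it has bounded.\<close>

lemma energy_weight_Suc_le: "energy_weight (Suc k) \<le> energy_weight k + (real k + 1)"
proof -
  have "(real k + 2) / (2 * real k + 3) \<le> (real k + 1) / (2 * real k + 1)"
    by (simp add: divide_simps) (simp add: algebra_simps)
  then have "(real k + 1)\<^sup>2 * ((real k + 2) / (2 * real k + 3))
      \<le> (real k + 1)\<^sup>2 * ((real k + 1) / (2 * real k + 1))"
    by (rule mult_left_mono) simp
  then show ?thesis
    unfolding energy_weight_add
    by (simp add: energy_weight_def power3_eq_cube power2_eq_square mult.assoc add.commute)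
qed

text \<open>The variables \<open>y\<close>, \<open>x\<close>, \<open>z\<close>, \<open>w\<close> stand for \<open>x k\<close>, \<open>x (k + 1)\<close>, \<open>z (k + 1)\<close>,
  \<open>z (k + 2)\<close>. The energy bounds from \<open>x\<close> to \<open>y\<close> and to \<open>m\<close>, added with weights
  \<open>energy_weight k\<close> and \<open>k + 1\<close>, give the cross term of \<open>(norm (w - m))\<^sup>2 / (2 * h)\<close>; its
  quadratic term \<open>(k + 1)\<^sup>2 / 2 * h * (norm (gradient f x))\<^sup>2\<close> is covered by the squared
  gradients that these bounds provide.\<close>

lemma potential_decrease:
  fixes f :: "'a::euclidean_space \<Rightarrow> real"
  assumes smooth: "L_smooth L f" "convex_on UNIV f" "0 < h" "h * L \<le> 1" "L > 0"
    and min: "\<forall>y. f m \<le> f y"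
    and avg: "(real k + 1)\<^sup>2 *\<^sub>R x =
      (real k)\<^sup>2 *\<^sub>R (y - h *\<^sub>R gradient f y) + (2 * real k + 1) *\<^sub>R z"
    and w: "w = z - (h * (real k + 1)) *\<^sub>R gradient f x"
  shows "energy_weight (Suc k) * energy h f m x + (norm (w - m))\<^sup>2 / (2 * h)
    \<le> energy_weight k * energy h f m y + (norm (z - m))\<^sup>2 / (2 * h)"
proof -
  let ?E = "energy h f m" and ?n = "real k + 1" and ?q = "energy_weight k"
  define g where "g = gradient f x"
  define p where "p = y - h *\<^sub>R gradient f y"
  have q0: "0 \<le> ?q" by (simp add: energy_weight_def)
  have E0: "0 \<le> ?E x" by (rule energy_nonneg[OF smooth(1,3,4) min])

  have "gradient f m = 0" by (rule gradient_at_minimizer[OF smooth(1,5) min])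
  then have star: "?E x + g \<bullet> (m - x) + h * (norm g)\<^sup>2 \<le> 0"
    using energy_lower_bound[OF smooth(1-4), of m x m] by (simp add: energy_def g_def)
  have prev: "?E x + g \<bullet> (p - x) + h * (norm g)\<^sup>2 \<le> ?E y"
    using energy_lower_bound[OF smooth(1-4), of m x y] by (simp add: g_def p_def)

  \<comment> \<open>The weights are the averaging coefficients \<open>k\<^sup>2\<close> and \<open>2 * k + 1\<close>, both multiplied by
    \<open>(k + 1) / (2 * k + 1)\<close>, so \<open>p\<close> and \<open>x\<close> cancel.\<close>
  have collapse: "?q * (g \<bullet> (p - x)) + ?n * (g \<bullet> (m - x)) = ?n * (g \<bullet> (m - z))"
  proof -
    have pos: "2 * real k + 1 > 0" by simp
    have "?n\<^sup>2 * (g \<bullet> x) = (real k)\<^sup>2 * (g \<bullet> p) + (2 * real k + 1) * (g \<bullet> z)"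
      using arg_cong[OF avg, of "\<lambda>u. g \<bullet> u"] by (simp add: p_def inner_add_right)
    then have "(real k)\<^sup>2 * ?n * (g \<bullet> p - g \<bullet> x)
        = (2 * real k + 1) * (?n * (g \<bullet> x) - ?n * (g \<bullet> z))"
      by algebra
    then have "?q * (g \<bullet> p - g \<bullet> x) = ?n * (g \<bullet> x) - ?n * (g \<bullet> z)"
      using pos by (simp add: energy_weight_def nonzero_divide_eq_eq mult.commute)
    then show ?thesis by (simp add: inner_diff_right algebra_simps)
  qed

  have "?q * (?E x + g \<bullet> (p - x) + h * (norm g)\<^sup>2) + ?n * (?E x + g \<bullet> (m - x) + h * (norm g)\<^sup>2)
      \<le> ?q * ?E y + ?n * 0"
    using q0 prev star by (intro add_mono mult_left_mono) auto
  then have weighted: "(?q + ?n) * ?E x + ?n * (g \<bullet> (m - z)) + (?q + ?n) * (h * (norm g)\<^sup>2)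
      \<le> ?q * ?E y"
    using collapse by (simp add: algebra_simps)

  have "(norm (w - m))\<^sup>2 = (norm (z - m))\<^sup>2 + 2 * h * ?n * (g \<bullet> (m - z)) + (h * ?n)\<^sup>2 * (norm g)\<^sup>2"
  proof -
    have "w - m = (z - m) - (h * ?n) *\<^sub>R g" by (simp add: w g_def)
    moreover have "(norm (u - c *\<^sub>R g))\<^sup>2 = (norm u)\<^sup>2 - 2 * c * (g \<bullet> u) + c\<^sup>2 * (norm g)\<^sup>2"
      for u :: 'a and c :: real
      by (simp add: power2_norm_eq_inner inner_diff_left inner_diff_right inner_commute
          power2_eq_square[of c] algebra_simps)
    moreover have "g \<bullet> (z - m) = - (g \<bullet> (m - z))" by (simp add: inner_diff_right)
    ultimately show ?thesis by (simp only:)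
  qed
  then have dist: "(norm (w - m))\<^sup>2 / (2 * h)
      = (norm (z - m))\<^sup>2 / (2 * h) + ?n * (g \<bullet> (m - z)) + ?n\<^sup>2 / 2 * (h * (norm g)\<^sup>2)"
    using smooth(3) by (simp add: field_simps power2_eq_square)

  have "?n\<^sup>2 / 2 \<le> ?q + ?n"
    using energy_weight_ge[of "Suc k"] energy_weight_Suc_le[of k] by (simp add: add.commute)
  then have "?n\<^sup>2 / 2 * (h * (norm g)\<^sup>2) \<le> (?q + ?n) * (h * (norm g)\<^sup>2)"
    using smooth(3) by (intro mult_right_mono) auto
  moreover have "energy_weight (Suc k) * ?E x \<le> (?q + ?n) * ?E x"
    using E0 energy_weight_Suc_le by (intro mult_right_mono) auto
  ultimately show ?thesis using weighted dist by linarith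
qed

section \<open>The convergence rate\<close>

theorem theorem5p1:
  fixes f :: "real ^ 'n \<Rightarrow> real"
    and L s :: real
    and X\<^sub>0 X_star :: "real ^ 'n"
    and \<theta> :: "nat \<Rightarrow> real"
    and x xplus z :: "nat \<Rightarrow> real ^ 'n"
  assumes "L > 0"
    and "convex_on UNIV f"
    and "L_smooth L f"
    and minimizer: "\<forall>y. f X_star \<le> f y"
    and "s \<in> {0<..2 / L}"
    and \<theta>: "\<And>k. \<theta> k = real k / 2"
    and "x 0 = X\<^sub>0"
    and "z 0 = X\<^sub>0"
    and xplus: "\<And>k. xplus k = x k - (s / 2) *\<^sub>R gradient f (x k)"
    and z_step: "\<And>k. z (k + 1) = z k - (s * \<theta> k) *\<^sub>R gradient f (x k)"
    and x_step: "\<And>k. x (k + 1) =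
      ((\<theta> k)\<^sup>2 / (\<theta> (k + 1))\<^sup>2) *\<^sub>R xplus k + (1 - (\<theta> k)\<^sup>2 / (\<theta> (k + 1))\<^sup>2) *\<^sub>R z (k + 1)"
  shows "\<forall>k\<ge>1. f (xplus k) - f X_star \<le> 2 * (norm (X\<^sub>0 - X_star))\<^sup>2 / (s * (real k)\<^sup>2)"
proof (intro allI impI)
  fix k :: nat
  assume k: "k \<ge> 1"
  define h where "h = s / 2"
  have h: "0 < h" "h * L \<le> 1"
    using assms(1,5) by (auto simp: h_def field_simps)
  let ?E = "\<lambda>k. energy h f X_star (x k)"
  let ?V = "\<lambda>k. energy_weight k * ?E k + (norm (z (k + 1) - X_star))\<^sup>2 / (2 * h)"

  have step: "?V (Suc k) \<le> ?V k" for k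
  proof (rule potential_decrease[OF assms(3,2) h assms(1) minimizer])
    show "z (Suc k + 1) = z (k + 1) - (h * (real k + 1)) *\<^sub>R gradient f (x (Suc k))"
      using z_step[of "Suc k"] by (simp add: \<theta> h_def add.commute)
    have ratio: "(\<theta> k)\<^sup>2 / (\<theta> (k + 1))\<^sup>2 = (real k)\<^sup>2 / (real k + 1)\<^sup>2"
      by (simp add: \<theta> power_divide add.commute)
    have "(real k + 1)\<^sup>2 *\<^sub>R x (Suc k)
        = ((real k + 1)\<^sup>2 * ((real k)\<^sup>2 / (real k + 1)\<^sup>2)) *\<^sub>R xplus k
          + ((real k + 1)\<^sup>2 * (1 - (real k)\<^sup>2 / (real k + 1)\<^sup>2)) *\<^sub>R z (k + 1)"
      using x_step[of k] unfolding ratio by (simp add: scaleR_add_right)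
    also have "(real k + 1)\<^sup>2 * ((real k)\<^sup>2 / (real k + 1)\<^sup>2) = (real k)\<^sup>2"
      by simp
    also have "(real k + 1)\<^sup>2 * (1 - (real k)\<^sup>2 / (real k + 1)\<^sup>2) = 2 * real k + 1"
      by (simp add: right_diff_distrib) (simp add: power2_eq_square algebra_simps)
    finally show "(real k + 1)\<^sup>2 *\<^sub>R x (Suc k) =
        (real k)\<^sup>2 *\<^sub>R (x k - h *\<^sub>R gradient f (x k)) + (2 * real k + 1) *\<^sub>R z (k + 1)"
      by (simp add: xplus h_def)
  qed
  have "?V k \<le> ?V 0" for k
    by (rule lift_Suc_antimono_le[of ?V, OF step]) simp
  moreover have "?V 0 = (norm (X\<^sub>0 - X_star))\<^sup>2 / (2 * h)"
    using z_step[of 0] assms(8) by (simp add: energy_weight_def \<theta>)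
  ultimately have "?V k \<le> (norm (X\<^sub>0 - X_star))\<^sup>2 / (2 * h)" by metis
  moreover have "0 \<le> (norm (z (k + 1) - X_star))\<^sup>2 / (2 * h)"
    using h by simp
  moreover have "(real k)\<^sup>2 / 2 * ?E k \<le> energy_weight k * ?E k"
    by (intro mult_right_mono energy_weight_ge energy_nonneg[OF assms(3) h minimizer])
  ultimately have "(real k)\<^sup>2 / 2 * ?E k \<le> (norm (X\<^sub>0 - X_star))\<^sup>2 / (2 * h)"
    by linarith
  then have "?E k \<le> 2 * (norm (X\<^sub>0 - X_star))\<^sup>2 / (s * (real k)\<^sup>2)"
    using k h(1) by (simp add: h_def field_simps)
  moreover have "f (xplus k) - f X_star \<le> ?E k"
    using gradient_step_decrease[OF assms(3) h, of "x k"]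
    by (simp add: energy_def xplus h_def)
  ultimately show "f (xplus k) - f X_star \<le> 2 * (norm (X\<^sub>0 - X_star))\<^sup>2 / (s * (real k)\<^sup>2)"
    by linarith
qed

end
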